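(* Let $d\ge 1$, let $K$ be a compact subset of $\mathbb{R}^d$, and let $\mu$ be a non-atomic, finite Borel measure supported on $K$ which is absolutely $\alpha$-friendly for some $\alpha>0$. Let $\psi:\mathbb{R}^+\to\mathbb{R}^+$ be a real, positive, decreasing function. If $$\sum_{r=1}^{\infty} r^{\alpha\frac{d+1}{d}-1}\,\psi(r)^{\alpha}<\infty,$$ then $\mu(W_K(\psi))=0$.
   Context: For a real, positive, decreasing function $\psi:\mathbb{R}^+\to\mathbb{R}^+$, the set of $\psi$-well approximable points is $$W(\psi):=\{\mathbf{x}=(x_1,\dots,x_d)\in\mathbb{R}^d:\ \max_{1\le i\le d}|x_i-p_i/q|\le\psi(q)\text{ for infinitely many }(\mathbf{p},q)\in\mathbb{Z}^d\times\mathbb{N}\},$$ and $W_K(\psi):=K\cap W(\psi)$. $B(x,r)$ denotes the Euclidean ball with centre $x$ and radius $r$. The measure $\mu$ is doubling if there exist constants $D>0$, $r_0>0$ such that $\mu(B(x,2r))\le D\,\mu(B(x,r))$ for all $x\in K$ and all $r<r_0$. For an affine hyperplane $L$ (of dimension $d-1$) in $\mathbb{R}^d$ and $\epsilon>0$, $L^{(\epsilon)}$ denotes the $\epsilon$-neighbourhood of $L$ (when $d=1$, $L$ is a point $a$ and $L^{(\epsilon)}=B(a,\epsilon)$). The measure $\mu$ is absolutely $\alpha$-decaying if there exist constants $C,\alpha,r_0>0$ such that for every such hyperplane $L$ and every $\epsilon>0$, $\mu(B(x,r)\cap L^{(\epsilon)})\le C(\epsilon/r)^{\alpha}\mu(B(x,r))$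 for all $x\in K$ and all $r<r_0$. The measure $\mu$ is absolutely $\alpha$-friendly if it is both doubling and absolutely $\alpha$-decaying. *)

theory Defs
  imports "HOL-Analysis.Analysis"
begin

definition well_approximable :: "(real \<Rightarrow> real) \<Rightarrow> (real ^ 'n) set" where
  "well_approximable \<psi> =
     {x. infinite {(p :: int ^ 'n, q :: nat). q \<ge> 1 \<and>
           (MAX i. \<bar>x $ i - of_int (p $ i) / of_nat q\<bar>) \<le> \<psi> (of_nat q)}}"

definition affine_hyperplane :: "'a::euclidean_space set \<Rightarrow> bool" where
  "affine_hyperplane L \<longleftrightarrow> affine L \<and> aff_dim L = int DIM('a) - 1"

definition open_nbhd :: "'a::metric_space set \<Rightarrow> real \<Rightarrow> 'a set" where
  "open_nbhd L \<epsilon> = (\<Union>y\<in>L. ball y \<epsilon>)"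

definition non_atomic :: "'a measure \<Rightarrow> bool" where
  "non_atomic M \<longleftrightarrow> (\<forall>A\<in>sets M. 0 < emeasure M A \<longrightarrow>
     (\<exists>B\<in>sets M. B \<subseteq> A \<and> 0 < emeasure M B \<and> emeasure M B < emeasure M A))"

definition supported_on :: "'a measure \<Rightarrow> 'a set \<Rightarrow> bool" where
  "supported_on M K \<longleftrightarrow> space M - K \<in> null_sets M"

text \<open>
  The three predicates below are meant for finite Borel measures: they use the real-valued
  \<^const>\<open>measure\<close>, which is 0 on sets of infinite measure.
  Balls and neighbourhoods are open; for absolutely friendly measures the closed variants give
  the same notion up to the constants.
\<close>

definition doubling_on :: "'a::metric_space measure \<Rightarrow> 'a set \<Rightarrow> bool" where
  "doubling_on M K \<longleftrightarrow> (\<exists>D r0. D > 0 \<and> r0 > 0 \<and>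
     (\<forall>x\<in>K. \<forall>r. 0 < r \<and> r < r0 \<longrightarrow>
        measure M (ball x (2 * r)) \<le> D * measure M (ball x r)))"

definition absolutely_decaying_on ::
    "real \<Rightarrow> 'a::euclidean_space measure \<Rightarrow> 'a set \<Rightarrow> bool" where
  "absolutely_decaying_on \<alpha> M K \<longleftrightarrow> \<alpha> > 0 \<and> (\<exists>C r0. C > 0 \<and> r0 > 0 \<and>
     (\<forall>L \<epsilon>. affine_hyperplane L \<and> \<epsilon> > 0 \<longrightarrow>
        (\<forall>x\<in>K. \<forall>r. 0 < r \<and> r < r0 \<longrightarrow>
           measure M (ball x r \<inter> open_nbhd L \<epsilon>)
             \<le> C * (\<epsilon> / r) powr \<alpha> * measure M (ball x r))))"

definition absolutely_friendly_on ::
    "real \<Rightarrow> 'a::euclidean_space measure \<Rightarrow> 'a set \<Rightarrow> bool" where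
  "absolutely_friendly_on \<alpha> M K \<longleftrightarrow> doubling_on M K \<and> absolutely_decaying_on \<alpha> M K"

end

theory Submission
  imports Defs
begin

text \<open>
  Simplex lemma: by the pigeonhole principle (Dirichlet's theorem for the linear form
  \<open>a \<bullet> x + b\<close>) there is a nonzero integer vector \<open>a\<close> with entries of size at most
  \<open>Q^(1/d)\<close>, up to a constant, and an integer \<open>b\<close> with \<open>\<bar>a \<bullet> x + b\<bar> < 1 / (2Q)\<close>. If \<open>p/q\<close> has
  \<open>q \<le> Q\<close> and lies within a small multiple of \<open>Q^(-(d+1)/d)\<close> of \<open>x\<close>, then \<open>a \<bullet> p + b q\<close> is an
  integer of absolute value less than \<open>1\<close>, so \<open>p/q\<close> lies on the hyperplane \<open>a \<bullet> y + b = 0\<close>.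

  Hence, on a ball of radius \<open>\<rho>\<close> comparable to \<open>2^(-n(d+1)/d)\<close>, the points approximable with
  denominator in \<open>[2^n, 2^(n+1))\<close> lie in the \<open>\<delta>\<close>-neighbourhood of one hyperplane, where \<open>\<delta>\<close> is
  comparable to \<open>\<psi>(2^n)\<close>. Decay bounds their measure by a multiple of \<open>(\<delta>/\<rho>)^\<alpha>\<close> times that of
  the ball; summing over balls centred at a separated net of \<open>K\<close>, whose overlaps the doubling
  property controls, the dyadic blocks have summable measures, and the Borel-Cantelli lemma applies.
\<close>

section \<open>Dirichlet's theorem and the simplex lemma\<close>

lemma dirichlet_linear_form:
  fixes x :: "real ^ 'n" and H :: nat
  assumes "H \<ge> 1"
  obtains a :: "int ^ 'n" and b :: int
  where "a \<noteq> 0" "\<And>i. \<bar>a $ i\<bar> \<le> int H"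
    "\<bar>(\<Sum>i\<in>UNIV. of_int (a $ i) * x $ i) + of_int b\<bar> < 1 / real H ^ CARD('n)"
proof -
  define S :: "('n \<Rightarrow> nat) set" where "S = UNIV \<rightarrow>\<^sub>E {0..H}"
  define lf where "lf f = (\<Sum>i\<in>UNIV. real (f i) * x $ i)" for f :: "'n \<Rightarrow> nat"
  define M :: real where "M = real H ^ CARD('n)"
  have M: "M > 0" using assms by (simp add: M_def)
  \<comment> \<open>With d = \<open>CARD('n)\<close>, cut [0,1) into \<open>H ^ d\<close> cells of
    length \<open>1 / M\<close>; \<open>g f\<close> is the index of the cell containing the
    fractional part of \<open>lf f\<close>. As \<open>S\<close> has \<open>(H + 1) ^ d\<close>
    elements, two of them share a cell.\<close>
  define g where "g f = nat \<lfloor>M * frac (lf f)\<rfloor>" for f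
  have "g ` S \<subseteq> {..<H ^ CARD('n)}"
  proof
    fix k assume "k \<in> g ` S"
    then obtain f where k: "k = g f" by auto
    have "M * frac (lf f) < M" using M frac_lt_1[of "lf f"] by simp
    moreover have "M * frac (lf f) \<ge> 0" using M by simp
    ultimately have "\<lfloor>M * frac (lf f)\<rfloor> < int (H ^ CARD('n))"
      by (simp add: floor_less_iff M_def)
    then show "k \<in> {..<H ^ CARD('n)}"
      using assms unfolding k g_def lessThan_iff by (subst nat_less_iff) (use M in auto)
  qed
  then have "card (g ` S) \<le> H ^ CARD('n)"
    using card_mono[of "{..<H ^ CARD('n)}"] by simp
  also have "\<dots> < (H + 1) ^ CARD('n)" by (intro power_strict_mono) auto
  also have "\<dots> = card S" by (simp add: S_def card_funcsetE)
  finally obtain f f' where f: "f \<in> S" "f' \<in> S" "f \<noteq> f'" and eq: "g f = g f'"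
    using pigeonhole[of g S] by (auto simp: inj_on_def)
  have "\<lfloor>M * frac (lf f)\<rfloor> = \<lfloor>M * frac (lf f')\<rfloor>"
    using eq M unfolding g_def by (subst (asm) eq_nat_nat_iff) auto
  then have "\<bar>M * frac (lf f) - M * frac (lf f')\<bar> < 1" by linarith
  then have "M * \<bar>frac (lf f) - frac (lf f')\<bar> < 1"
    using M unfolding right_diff_distrib[symmetric] abs_mult by simp
  then have *: "\<bar>frac (lf f) - frac (lf f')\<bar> < 1 / M"
    using M by (simp add: pos_less_divide_eq mult.commute)
  show thesis
  \<comment> \<open>The floors are absorbed into \<open>b\<close>, so the linear form at
    \<open>x\<close> becomes exactly \<open>frac (lf f) - frac (lf f')\<close>.\<close>
  proof (rule that[of "\<chi> i. int (f i) - int (f' i)" "\<lfloor>lf f'\<rfloor> - \<lfloor>lf f\<rfloor>"])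
    show "(\<chi> i. int (f i) - int (f' i)) \<noteq> 0"
      using f(3) by (auto simp: vec_eq_iff fun_eq_iff)
    fix i
    have "f i \<le> H" "f' i \<le> H" using f by (auto simp: S_def PiE_def Pi_def)
    then show "\<bar>(\<chi> i. int (f i) - int (f' i)) $ i\<bar> \<le> int H" by auto
  next
    show "\<bar>(\<Sum>i\<in>UNIV. of_int ((\<chi> i. int (f i) - int (f' i)) $ i) * x $ i)
        + of_int (\<lfloor>lf f'\<rfloor> - \<lfloor>lf f\<rfloor>)\<bar> < 1 / real H ^ CARD('n)"
      using * by (simp add: lf_def M_def frac_def sum_subtractf left_diff_distrib algebra_simps)
  qed
qed

definition rational_point :: "int ^ 'n \<Rightarrow> nat \<Rightarrow> real ^ 'n" where
  "rational_point p q = (\<chi> i. of_int (p $ i) / of_nat q)"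

text \<open>The allowance \<open>1 / Q\<close> for the form at \<open>p/q\<close> is split into two
  halves: the Dirichlet bound at \<open>x\<close>, and the change of the form between
  \<open>x\<close> and \<open>p/q\<close>, which is at most \<open>d * H * r\<close>. The form is
  chosen from \<open>x\<close> and \<open>Q\<close> alone, so one hyperplane serves all these
  rational points.\<close>

lemma rational_points_in_hyperplane:
  fixes x :: "real ^ 'n" and Q r :: real
  assumes Q: "Q \<ge> 1" and r: "r \<le> 1 / (8 * CARD('n) * Q powr (1 + 1 / CARD('n)))"
  obtains L where "affine_hyperplane L"
    "\<And>(p :: int ^ 'n) q. 1 \<le> q \<Longrightarrow> real q \<le> Q \<Longrightarrow> dist x (rational_point p q) \<le> r
       \<Longrightarrow> rational_point p q \<in> L"
proof -
  define d where "d = real CARD('n)"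
  have d: "d \<ge> 1" by (simp add: d_def Suc_leI)
  \<comment> \<open>Rounding up gives \<open>H ^ d \<ge> 2 * Q\<close>, hence a Dirichlet error
    below \<open>1 / (2 * Q)\<close>. The rounded number is at least 1, so rounding at most doubles
    it; a further factor \<open>2 powr (1 / d) \<le> 2\<close> gives the 4 in
    \<open>HQ\<close>.\<close>
  define H where "H = nat \<lceil>(2 * Q) powr (1 / d)\<rceil>"
  have T: "(2 * Q) powr (1 / d) \<ge> 1" using Q d by (intro ge_one_powr_ge_zero) auto
  have H1: "real H \<ge> (2 * Q) powr (1 / d)" unfolding H_def by linarith
  have H2: "real H \<le> (2 * Q) powr (1 / d) + 1" using T unfolding H_def by linarith
  have Hge1: "H \<ge> 1" using H1 T by linarith
  have "2 powr (1 / d) \<le> (2 :: real) powr 1" using d by (intro powr_mono) auto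
  then have "(2 * Q) powr (1 / d) \<le> 2 * Q powr (1 / d)"
    using Q by (simp add: powr_mult mult_right_mono)
  with H2 T have HQ: "real H \<le> 4 * Q powr (1 / d)" by linarith
  have "2 * Q = ((2 * Q) powr (1 / d)) powr d" using Q d by (simp add: powr_powr)
  also have "\<dots> \<le> real H powr d" using H1 d by (intro powr_mono2) auto
  also have "\<dots> = real H ^ CARD('n)" using Hge1 by (simp add: d_def powr_realpow)
  finally have HdQ: "2 * Q \<le> real H ^ CARD('n)" .
  obtain a :: "int ^ 'n" and b where a: "a \<noteq> 0" "\<And>i. \<bar>a $ i\<bar> \<le> int H"
    and ab: "\<bar>(\<Sum>i\<in>UNIV. of_int (a $ i) * x $ i) + of_int b\<bar> < 1 / real H ^ CARD('n)"
    using dirichlet_linear_form[OF Hge1, of x] by blast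
  define v :: "real ^ 'n" where "v = (\<chi> i. of_int (a $ i))"
  have "v \<noteq> 0" using a(1) by (simp add: v_def vec_eq_iff)
  have vx: "v \<bullet> x = (\<Sum>i\<in>UNIV. of_int (a $ i) * x $ i)" for x
    by (simp add: v_def inner_vec_def)
  show thesis
  proof (rule that[of "{y. v \<bullet> y = - of_int b}"])
    show "affine_hyperplane {y. v \<bullet> y = - of_int b}"
      using \<open>v \<noteq> 0\<close> by (simp add: Defs.affine_hyperplane_def affine_hyperplane aff_dim_hyperplane)
    fix p :: "int ^ 'n" and q :: nat
    assume q: "1 \<le> q" "real q \<le> Q" and dist: "dist x (rational_point p q) \<le> r"
    define y where "y = rational_point p q"
    define N where "N = (\<Sum>i\<in>UNIV. a $ i * p $ i) + b * int q"
    have qy: "real q * (v \<bullet> y + of_int b) = of_int N"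
      using q(1) by (simp add: N_def vx y_def rational_point_def sum_distrib_left algebra_simps)
    have "\<bar>v \<bullet> (y - x)\<bar> \<le> (\<Sum>i\<in>UNIV. \<bar>of_int (a $ i) * (y - x) $ i\<bar>)"
      unfolding vx by (rule sum_abs)
    also have "\<dots> \<le> (\<Sum>i\<in>(UNIV :: 'n set). real H * r)"
    proof (rule sum_mono)
      fix i
      have "\<bar>real_of_int (a $ i)\<bar> \<le> real H" using a(2)[of i] by linarith
      moreover have "\<bar>(y - x) $ i\<bar> \<le> r"
        using component_le_norm_cart[of "y - x" i] dist
        by (simp add: y_def dist_norm norm_minus_commute)
      ultimately show "\<bar>of_int (a $ i) * (y - x) $ i\<bar> \<le> real H * r"
        unfolding abs_mult by (intro mult_mono) auto
    qed
    also have "\<dots> = d * real H * r" by (simp add: d_def)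
    \<comment> \<open>Here \<open>r \<ge> 0\<close> because it bounds a distance. The constant
      \<open>8 * d\<close> in the hypothesis on \<open>r\<close> is twice \<open>4 * d\<close>,
      which leaves the half of \<open>1 / Q\<close>.\<close>
    also have "\<dots> \<le> d * (4 * Q powr (1 / d)) * (1 / (8 * d * Q powr (1 + 1 / d)))"
      using HQ r d dist order_trans[OF zero_le_dist dist]
      by (intro mult_mono) (auto simp: d_def)
    also have "\<dots> = 1 / (2 * Q)"
      using Q d unfolding powr_add by (simp add: divide_simps)
    finally have 1: "\<bar>v \<bullet> (y - x)\<bar> \<le> 1 / (2 * Q)" .
    have "\<bar>v \<bullet> x + of_int b\<bar> < 1 / real H ^ CARD('n)" using ab by (simp add: vx)
    also have "\<dots> \<le> 1 / (2 * Q)" using HdQ Q Hge1 by (intro divide_left_mono) auto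
    finally have "\<bar>v \<bullet> y + of_int b\<bar> < 1 / (2 * Q) + 1 / (2 * Q)"
      using 1 unfolding inner_diff_right by linarith
    then have 2: "\<bar>v \<bullet> y + of_int b\<bar> < 1 / Q" by simp
    have "\<bar>of_int N :: real\<bar> = real q * \<bar>v \<bullet> y + of_int b\<bar>" unfolding qy[symmetric] by (simp add: abs_mult)
    also have "\<dots> < real q * (1 / Q)" using q 2 by (intro mult_strict_left_mono) auto
    also have "\<dots> \<le> 1" using q Q by (simp add: field_simps)
    finally have "N = 0" by linarith
    then have "v \<bullet> y + of_int b = 0" using qy q by auto
    then show "rational_point p q \<in> {y. v \<bullet> y = - of_int b}" by (simp add: y_def)
  qed
qed

section \<open>Separated nets and sets that lie locally near hyperplanes\<close>

text \<open>Choosing a maximal separated set among the centres of a finite cover makes its existence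
  a matter of finiteness. A point of \<open>K\<close> is within \<open>e\<close> of a centre, which
  by maximality is within \<open>e\<close> of \<open>T\<close>; hence the radius
  \<open>2 * e\<close>.\<close>

lemma compact_separated_net:
  fixes K :: "'a :: metric_space set"
  assumes "compact K" "e > 0"
  obtains T where "finite T" "T \<subseteq> K" "K \<subseteq> (\<Union>t\<in>T. ball t (2 * e))"
    "\<And>s t. s \<in> T \<Longrightarrow> t \<in> T \<Longrightarrow> s \<noteq> t \<Longrightarrow> dist s t \<ge> e"
proof -
  obtain F where F: "finite F" "F \<subseteq> K" "K \<subseteq> (\<Union>x\<in>F. ball x e)"
    using compactE_image[OF assms(1), of K "\<lambda>x. ball x e"] assms(2) by force
  define \<S> where "\<S> = {T. T \<subseteq> F \<and> (\<forall>s\<in>T. \<forall>t\<in>T. s \<noteq> t \<longrightarrow> dist s t \<ge> e)}"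
  have "finite \<S>" "\<S> \<noteq> {}" using F(1) by (auto simp: \<S>_def)
  then obtain T where T: "T \<in> \<S>" and max: "\<And>U. U \<in> \<S> \<Longrightarrow> T \<subseteq> U \<Longrightarrow> T = U"
    using finite_has_maximal[of \<S>] by blast
  have near: "\<exists>t\<in>T. dist t x < e" if "x \<in> F" for x
  proof (rule ccontr)
    assume *: "\<not> ?thesis"
    then have "insert x T \<in> \<S>" using T that by (auto simp: \<S>_def not_less dist_commute)
    then have "x \<in> T" using max by blast
    with * show False using assms(2) by auto
  qed
  show thesis
  proof
    show "finite T" "T \<subseteq> K" "\<And>s t. s \<in> T \<Longrightarrow> t \<in> T \<Longrightarrow> s \<noteq> t \<Longrightarrow> dist s t \<ge> e"
      using T F finite_subset by (auto simp: \<S>_def)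
    show "K \<subseteq> (\<Union>t\<in>T. ball t (2 * e))"
    proof
      fix y assume "y \<in> K"
      then obtain x where x: "x \<in> F" "dist x y < e" using F(3) by auto
      obtain t where "t \<in> T" "dist t x < e" using near[OF x(1)] by auto
      moreover have "dist t y \<le> dist t x + dist x y" by (rule dist_triangle)
      ultimately show "y \<in> (\<Union>t\<in>T. ball t (2 * e))" using x by force
    qed
  qed
qed

text \<open>For a \<open>\<rho> / 2\<close>-separated net, the balls of radius \<open>\<rho>\<close>
  cover \<open>K\<close> while those of radius \<open>\<rho> / 4\<close> are disjoint, so the latter
  have total measure at most that of the space. Two doublings lead from one radius to the other,
  whence \<open>D\<^sup>2\<close>. In the application \<open>c\<close> is
  \<open>C * (\<delta> / \<rho>) powr \<alpha>\<close>.\<close>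

lemma measure_locally_near_hyperplanes_le:
  fixes \<mu> :: "'a :: euclidean_space measure"
  assumes "compact K" and sets: "sets \<mu> = sets borel" and "finite_measure \<mu>"
    and doubling: "\<And>x r. x \<in> K \<Longrightarrow> 0 < r \<Longrightarrow> r < \<rho> \<Longrightarrow>
      measure \<mu> (ball x (2 * r)) \<le> D * measure \<mu> (ball x r)"
    and decaying: "\<And>L x. affine_hyperplane L \<Longrightarrow> x \<in> K \<Longrightarrow>
      measure \<mu> (ball x \<rho> \<inter> open_nbhd L \<delta>) \<le> c * measure \<mu> (ball x \<rho>)"
    and "D > 0" "c \<ge> 0" "\<rho> > 0"
    and A: "A \<in> sets \<mu>" "A \<subseteq> K"
    and near: "\<And>x. x \<in> K \<Longrightarrow> \<exists>L. affine_hyperplane L \<and> A \<inter> ball x \<rho> \<subseteq> open_nbhd L \<delta>"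
  shows "measure \<mu> A \<le> c * D\<^sup>2 * measure \<mu> (space \<mu>)"
proof -
  interpret finite_measure \<mu> by fact
  obtain T where T: "finite T" "T \<subseteq> K" "K \<subseteq> (\<Union>t\<in>T. ball t (2 * (\<rho> / 2)))"
    and sep: "\<And>s t. s \<in> T \<Longrightarrow> t \<in> T \<Longrightarrow> s \<noteq> t \<Longrightarrow> dist s t \<ge> \<rho> / 2"
    using compact_separated_net[OF \<open>compact K\<close>, of "\<rho> / 2"] \<open>\<rho> > 0\<close> by auto
  have [simp]: "open S \<Longrightarrow> S \<in> sets \<mu>" for S by (simp add: sets)
  have nbhd [simp]: "open (open_nbhd L \<delta>)" for L :: "'a set" by (auto simp: open_nbhd_def)
  have local: "measure \<mu> (A \<inter> ball t \<rho>) \<le> c * (D\<^sup>2 * measure \<mu> (ball t (\<rho> / 4)))" if "t \<in> T" for t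
  proof -
    have t: "t \<in> K" using that T by auto
    then obtain L where L: "affine_hyperplane L" "A \<inter> ball t \<rho> \<subseteq> open_nbhd L \<delta>" using near by blast
    have "measure \<mu> (A \<inter> ball t \<rho>) \<le> measure \<mu> (ball t \<rho> \<inter> open_nbhd L \<delta>)"
      using L(2) by (intro finite_measure_mono) (auto intro: open_Int)
    also have "\<dots> \<le> c * measure \<mu> (ball t \<rho>)" by (rule decaying[OF L(1) t])
    also have "measure \<mu> (ball t \<rho>) \<le> D * measure \<mu> (ball t (\<rho> / 2))"
      using doubling[OF t, of "\<rho> / 2"] \<open>\<rho> > 0\<close> by simp
    also have "measure \<mu> (ball t (\<rho> / 2)) \<le> D * measure \<mu> (ball t (\<rho> / 4))"
      using doubling[OF t, of "\<rho> / 4"] \<open>\<rho> > 0\<close> by simp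
    finally show ?thesis
      using \<open>D > 0\<close> \<open>c \<ge> 0\<close> by (simp add: power2_eq_square mult_left_mono mult.assoc)
  qed
  have "A \<subseteq> (\<Union>t\<in>T. A \<inter> ball t \<rho>)" using A(2) T(3) by auto
  then have "measure \<mu> A \<le> measure \<mu> (\<Union>t\<in>T. A \<inter> ball t \<rho>)"
    using A(1) T(1) by (intro finite_measure_mono sets.finite_UN) auto
  also have "\<dots> \<le> (\<Sum>t\<in>T. measure \<mu> (A \<inter> ball t \<rho>))"
    using A(1) T(1) by (intro measure_UNION_le) auto
  also have "\<dots> \<le> (\<Sum>t\<in>T. c * (D\<^sup>2 * measure \<mu> (ball t (\<rho> / 4))))"
    by (intro sum_mono local)
  also have "\<dots> = c * D\<^sup>2 * (\<Sum>t\<in>T. measure \<mu> (ball t (\<rho> / 4)))"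
    by (simp add: sum_distrib_left mult.assoc)
  also have "(\<Sum>t\<in>T. measure \<mu> (ball t (\<rho> / 4))) = measure \<mu> (\<Union>t\<in>T. ball t (\<rho> / 4))"
  proof (rule finite_measure_finite_Union[symmetric])
    show "disjoint_family_on (\<lambda>t. ball t (\<rho> / 4)) T"
    proof (unfold disjoint_family_on_def, intro ballI impI)
      fix s t assume st: "s \<in> T" "t \<in> T" "s \<noteq> t"
      show "ball s (\<rho> / 4) \<inter> ball t (\<rho> / 4) = {}"
        using sep[OF st] by (intro disjoint_ballI) simp
    qed
  qed (use T in auto)
  also have "\<dots> \<le> measure \<mu> (space \<mu>)" by (rule bounded_measure)
  finally show ?thesis using \<open>c \<ge> 0\<close> by (simp add: mult_left_mono)
qed

section \<open>Dyadic condensation of the series\<close>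

text \<open>This is Cauchy condensation, but the terms need not be monotone, since
  \<open>s - 1\<close> may have either sign. Only \<psi> is compared by monotonicity; on a dyadic
  block the power varies by at most a factor \<open>2 powr \<bar>s - 1\<bar>\<close>.\<close>

lemma summable_dyadic:
  fixes \<psi> :: "real \<Rightarrow> real"
  assumes \<alpha>: "\<alpha> > 0" and pos: "\<And>t. t > 0 \<Longrightarrow> \<psi> t > 0" and anti: "antimono_on {0<..} \<psi>"
    and summ: "summable (\<lambda>k. real (Suc k) powr (s - 1) * \<psi> (real (Suc k)) powr \<alpha>)"
  shows "summable (\<lambda>n. (2 ^ n) powr s * \<psi> (2 ^ n) powr \<alpha>)"
proof -
  define f where "f k = real (Suc k) powr (s - 1) * \<psi> (real (Suc k)) powr \<alpha>" for k
  define g where "g n = (2 ^ n) powr s * \<psi> (2 ^ n) powr \<alpha>" for n :: nat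
  define c :: real where "c = 2 * 2 powr \<bar>s - 1\<bar>"
  have f0: "f k \<ge> 0" for k by (simp add: f_def)
  have g0: "g k \<ge> 0" for k by (simp add: g_def)
  have block: "g (Suc n) \<le> c * (\<Sum>k = 2^n..<2^Suc n. f k)" for n
  proof -
    \<comment> \<open>The arguments \<open>Suc k\<close> run over the integers in (R/2, R]. As
      \<psi> decreases, its smallest value there is at the right end \<open>R\<close>, so block
      \<open>n\<close> controls \<open>g (Suc n)\<close> rather than \<open>g n\<close>.\<close>
    define R :: real where "R = 2 ^ Suc n"
    have R: "R > 0" by (simp add: R_def)
    have "R powr (s - 1) * (1 / 2) powr \<bar>s - 1\<bar> * \<psi> R powr \<alpha> \<le> f k"
      if k: "k \<in> {2^n..<2^Suc n}" for k
    proof -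
      have k1: "Suc k \<le> 2 ^ Suc n" and k2: "2 ^ Suc n \<le> 2 * Suc k" using k by auto
      have kR: "real (Suc k) \<le> R" unfolding R_def using k1
        by (metis of_nat_le_iff of_nat_numeral of_nat_power)
      have Rk: "R \<le> 2 * real (Suc k)" unfolding R_def using k2
        by (metis of_nat_le_iff of_nat_numeral of_nat_power of_nat_mult)
      \<comment> \<open>Since \<open>u\<close> lies in [1/2, 1], raising the exponent from
        \<open>s - 1\<close> to its absolute value only lowers the power; this treats both signs at
        once.\<close>
      define u where "u = real (Suc k) / R"
      have u: "1 / 2 \<le> u" "u \<le> 1" using kR Rk R by (auto simp: u_def field_simps)
      have "(1 / 2) powr \<bar>s - 1\<bar> \<le> u powr \<bar>s - 1\<bar>" using u by (intro powr_mono2) auto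
      also have "\<dots> \<le> u powr (s - 1)" using u by (intro powr_mono') auto
      finally have "R powr (s - 1) * (1 / 2) powr \<bar>s - 1\<bar> \<le> R powr (s - 1) * u powr (s - 1)"
        by (intro mult_left_mono) auto
      also have "\<dots> = real (Suc k) powr (s - 1)" using u R
        by (subst powr_mult[symmetric]) (auto simp: u_def)
      finally have 1: "R powr (s - 1) * (1 / 2) powr \<bar>s - 1\<bar> \<le> real (Suc k) powr (s - 1)" .
      have "\<psi> R \<le> \<psi> (real (Suc k))"
        using monotone_onD[OF anti, of "real (Suc k)" R] kR R by auto
      then have "\<psi> R powr \<alpha> \<le> \<psi> (real (Suc k)) powr \<alpha>"
        using pos[OF R] \<alpha> by (intro powr_mono2) auto
      with 1 show ?thesis unfolding f_def by (intro mult_mono) auto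
    qed
    then have "(\<Sum>k::nat = 2^n..<2^Suc n. R powr (s - 1) * (1 / 2) powr \<bar>s - 1\<bar> * \<psi> R powr \<alpha>)
        \<le> (\<Sum>k = 2^n..<2^Suc n. f k)"
      by (rule sum_mono)
    moreover have "(\<Sum>k::nat = 2^n..<2^Suc n. R powr (s - 1) * (1 / 2) powr \<bar>s - 1\<bar> * \<psi> R powr \<alpha>)
        = R / 2 * (R powr (s - 1) * (1 / 2) powr \<bar>s - 1\<bar> * \<psi> R powr \<alpha>)"
      by (simp add: R_def)
    moreover have "c * (R / 2 * (R powr (s - 1) * (1 / 2) powr \<bar>s - 1\<bar> * \<psi> R powr \<alpha>)) = g (Suc n)"
    proof -
      have "R * R powr (s - 1) = R powr s" using R by (simp add: powr_mult_base)
      moreover have "2 powr \<bar>s - 1\<bar> * (1 / 2 :: real) powr \<bar>s - 1\<bar> = 1"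
        by (subst powr_mult[symmetric]) auto
      ultimately show ?thesis unfolding c_def g_def R_def[symmetric] by (simp add: algebra_simps)
    qed
    moreover have "c > 0" by (simp add: c_def)
    ultimately show ?thesis by (metis mult_left_mono less_imp_le)
  qed
  have "(\<Sum>n<N. g (Suc n)) \<le> c * suminf f" for N
  proof -
    have "(\<Sum>n<N. g (Suc n)) \<le> (\<Sum>n<N. c * (\<Sum>k = 2^n..<2^Suc n. f k))"
      by (intro sum_mono block)
    also have "\<dots> = c * (\<Sum>k = 1..<2^N. f k)"
    proof (induction N)
      case (Suc N)
      have "(\<Sum>k = 1..<2^N. f k) + (\<Sum>k = 2^N..<2^Suc N. f k) = (\<Sum>k = 1..<2^Suc N. f k)"
        by (intro sum.atLeastLessThan_concat) auto
      with Suc show ?case by (simp add: distrib_left[symmetric])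
    qed simp
    also have "\<dots> \<le> c * suminf f"
      using summ f0 by (intro mult_left_mono sum_le_suminf) (auto simp: c_def f_def)
    finally show ?thesis .
  qed
  then have "summable (\<lambda>n. g (Suc n))" by (intro summableI_nonneg_bounded g0)
  then have "summable g" by (simp only: summable_Suc_iff)
  then show ?thesis by (simp add: g_def[abs_def])
qed

section \<open>The well approximable points as a limsup set\<close>

definition approximable_with :: "(real \<Rightarrow> real) \<Rightarrow> nat \<Rightarrow> (real ^ 'n) set" where
  "approximable_with \<psi> q = {x. \<exists>p :: int ^ 'n. \<forall>i. \<bar>x $ i - of_int (p $ i) / of_nat q\<bar> \<le> \<psi> (of_nat q)}"

lemma approximable_with_borel: "approximable_with \<psi> q \<in> sets borel"
proof -
  have "approximable_with \<psi> q = (\<Union>p :: int ^ 'n. {x. \<forall>i. \<bar>x $ i - of_int (p $ i) / of_nat q\<bar> \<le> \<psi> (of_nat q)})"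
    by (auto simp: approximable_with_def)
  moreover have "closed {x :: real ^ 'n. \<forall>i. \<bar>x $ i - of_int (p $ i) / of_nat q\<bar> \<le> \<psi> (of_nat q)}"
    for p :: "int ^ 'n"
    by (intro closed_Collect_all closed_Collect_le continuous_intros)
  ultimately show ?thesis
    by (metis (no_types, lifting) borel_closed sets.countable_UN'' UNIV_I countableI_type)
qed

lemma finite_int_vec_bounded: "finite {p :: int ^ 'n. \<forall>i. \<bar>p $ i\<bar> \<le> B}"
proof -
  have "{p :: int ^ 'n. \<forall>i. \<bar>p $ i\<bar> \<le> B} \<subseteq> vec_lambda ` (UNIV \<rightarrow>\<^sub>E {-B..B})"
  proof
    fix p :: "int ^ 'n" assume "p \<in> {p. \<forall>i. \<bar>p $ i\<bar> \<le> B}"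
    then have "vec_nth p \<in> UNIV \<rightarrow>\<^sub>E {-B..B}" by (auto simp: abs_le_iff minus_le_iff)
    then show "p \<in> vec_lambda ` (UNIV \<rightarrow>\<^sub>E {-B..B})"
      by (metis image_eqI vec_nth_inverse)
  qed
  moreover have "finite (vec_lambda ` ((UNIV :: 'n set) \<rightarrow>\<^sub>E {-B..B}))"
    by (intro finite_imageI finite_PiE) auto
  ultimately show ?thesis by (rule finite_subset)
qed

text \<open>For fixed \<open>x\<close> and \<open>q\<close> only finitely many \<open>p\<close>
  qualify, as their entries are at most \<open>q * (\<psi> q + norm x)\<close> in size. Hence
  infinitely many pairs means infinitely many denominators, the form needed for
  Borel-Cantelli.\<close>

lemma well_approximable_iff:
  fixes x :: "real ^ 'n"
  shows "x \<in> well_approximable \<psi> \<longleftrightarrow> (\<forall>N. \<exists>q\<ge>N. q \<ge> 1 \<and> x \<in> approximable_with \<psi> q)"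
proof -
  define P where "P q = {p :: int ^ 'n. \<forall>i. \<bar>x $ i - of_int (p $ i) / of_nat q\<bar> \<le> \<psi> (of_nat q)}" for q
  \<comment> \<open>Empty fibres are excluded so that \<open>Qs\<close> is exactly the projection of
    the set of pairs.\<close>
  define Qs where "Qs = {q. q \<ge> 1 \<and> P q \<noteq> {}}"
  have pairs: "{(p :: int ^ 'n, q :: nat). q \<ge> 1 \<and>
           (MAX i. \<bar>x $ i - of_int (p $ i) / of_nat q\<bar>) \<le> \<psi> (of_nat q)} = prod.swap ` (SIGMA q:Qs. P q)"
    by (force simp: P_def Qs_def image_iff)
  have fin: "finite (P q)" if "q \<ge> 1" for q
  proof -
    define B where "B = \<lceil>real q * (\<psi> (real q) + norm x)\<rceil>"
    have "\<bar>p $ i\<bar> \<le> B" if "p \<in> P q" for p i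
    proof -
      have "\<bar>x $ i - of_int (p $ i) / real q\<bar> \<le> \<psi> (real q)" using that by (auto simp: P_def)
      then have "\<bar>of_int (p $ i) / real q\<bar> \<le> \<psi> (real q) + norm x"
        using component_le_norm_cart[of x i] by linarith
      then have "\<bar>of_int (p $ i)\<bar> \<le> real q * (\<psi> (real q) + norm x)"
        using \<open>q \<ge> 1\<close> by (simp add: field_simps)
      then show ?thesis unfolding B_def by linarith
    qed
    then have "P q \<subseteq> {p. \<forall>i. \<bar>p $ i\<bar> \<le> B}" by auto
    then show ?thesis using finite_int_vec_bounded finite_subset by blast
  qed
  have "x \<in> well_approximable \<psi> \<longleftrightarrow> infinite (SIGMA q:Qs. P q)"
    unfolding well_approximable_def mem_Collect_eq pairs by (subst finite_image_iff) auto
  also have "\<dots> \<longleftrightarrow> infinite Qs"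
  proof -
    have "finite Qs \<Longrightarrow> finite (SIGMA q:Qs. P q)" using fin by (auto simp: Qs_def intro!: finite_SigmaI)
    moreover have "Qs = fst ` (SIGMA q:Qs. P q)" by (force simp: Qs_def)
    ultimately show ?thesis by (metis finite_imageI)
  qed
  also have "\<dots> \<longleftrightarrow> (\<forall>N. \<exists>q\<ge>N. q \<ge> 1 \<and> x \<in> approximable_with \<psi> q)"
    by (auto simp: infinite_nat_iff_unbounded_le Qs_def P_def approximable_with_def)
  finally show ?thesis .
qed

section \<open>Measure of the dyadic blocks and conclusion\<close>

theorem theorem1:
  fixes K :: "(real ^ 'n) set"
    and \<mu> :: "(real ^ 'n) measure"
    and \<alpha> :: real
    and \<psi> :: "real \<Rightarrow> real"
  assumes "compact K"
    and "sets \<mu> = sets borel"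
    and "finite_measure \<mu>"
    and "non_atomic \<mu>"
    and "supported_on \<mu> K"
    and "\<alpha> > 0"
    and "absolutely_friendly_on \<alpha> \<mu> K"
    and "\<And>t. t > 0 \<Longrightarrow> \<psi> t > 0"
    and "antimono_on {0<..} \<psi>"
    and "summable (\<lambda>r. real (Suc r) powr (\<alpha> * ((real CARD('n) + 1) / real CARD('n)) - 1)
                        * \<psi> (real (Suc r)) powr \<alpha>)"
  shows "K \<inter> well_approximable \<psi> \<in> null_sets \<mu>"
proof -
  interpret finite_measure \<mu> by fact
  define d where "d = real CARD('n)"
  have d: "d \<ge> 1" by (simp add: d_def Suc_leI)
  define \<tau> where "\<tau> = 1 + 1 / d"
  have \<tau>: "(real CARD('n) + 1) / real CARD('n) = \<tau>" using d by (simp add: \<tau>_def d_def field_simps)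
  have \<tau>1: "\<tau> \<ge> 1" using d by (simp add: \<tau>_def)
  obtain D r1 where D: "D > 0" "r1 > 0" and doubling:
    "\<And>x r. x \<in> K \<Longrightarrow> 0 < r \<Longrightarrow> r < r1 \<Longrightarrow> measure \<mu> (ball x (2 * r)) \<le> D * measure \<mu> (ball x r)"
    using assms(7) unfolding absolutely_friendly_on_def doubling_on_def by metis
  obtain C r2 where C: "C > 0" "r2 > 0" and decaying:
    "\<And>L \<epsilon> x r. affine_hyperplane L \<Longrightarrow> \<epsilon> > 0 \<Longrightarrow> x \<in> K \<Longrightarrow> 0 < r \<Longrightarrow> r < r2 \<Longrightarrow>
      measure \<mu> (ball x r \<inter> open_nbhd L \<epsilon>) \<le> C * (\<epsilon> / r) powr \<alpha> * measure \<mu> (ball x r)"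
    using assms(7) unfolding absolutely_friendly_on_def absolutely_decaying_on_def by metis
  define E where "E n = K \<inter> (\<Union>q\<in>{2^n..<2^Suc n}. approximable_with \<psi> q)" for n
  have E_sets: "E n \<in> sets \<mu>" for n
    unfolding E_def assms(2)
    using compact_imp_closed[OF assms(1)] approximable_with_borel
    by (intro sets.Int sets.finite_UN) auto
  \<comment> \<open>The sum norm gives distance at most \<open>d * \<psi> (2 ^ n)\<close> to the
    rational point; the factor 2 makes room for an open neighbourhood. The radius
    \<open>\<rho> n\<close> is half of what the simplex lemma allows for
    \<open>Q = 2 ^ Suc n\<close>, since rational points near a ball of radius
    \<open>\<rho> n\<close> may lie outside it.\<close>
  define \<delta> where "\<delta> n = 2 * d * \<psi> (2 ^ n)" for n :: nat
  define \<rho> where "\<rho> n = 1 / (16 * d * (2 ^ Suc n) powr \<tau>)" for n :: nat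
  have \<delta>: "\<delta> n > 0" for n using d assms(8) by (simp add: \<delta>_def)
  have \<rho>: "\<rho> n > 0" for n using d by (simp add: \<rho>_def)
  define S where "S = measure \<mu> (space \<mu>)"
  have S: "S \<ge> 0" by (simp add: S_def)
  \<comment> \<open>If \<open>\<delta> n \<le> 2 * \<rho> n\<close>, the rational points stay within
    \<open>2 * \<rho> n\<close> of the centre and the hyperplane estimate applies. Otherwise the
    ratio exceeds 1 and the total mass \<open>S\<close> is a sufficient bound; the summand 1 in
    \<open>1 + C * D\<^sup>2\<close> covers this case.\<close>
  have E_le: "measure \<mu> (E n) \<le> (1 + C * D\<^sup>2) * S * (\<delta> n / \<rho> n) powr \<alpha>"
    if small: "\<rho> n < min r1 r2" for n
  proof (cases "\<delta> n \<le> 2 * \<rho> n")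
    case True
    have "measure \<mu> (E n) \<le> (C * (\<delta> n / \<rho> n) powr \<alpha>) * D\<^sup>2 * measure \<mu> (space \<mu>)"
    proof (rule measure_locally_near_hyperplanes_le[where \<delta> = "\<delta> n" and \<rho> = "\<rho> n" and K = K])
      fix z assume "z \<in> K"
      have r: "2 * \<rho> n \<le> 1 / (8 * CARD('n) * (2 ^ Suc n) powr (1 + 1 / CARD('n)))"
        by (simp add: \<rho>_def \<tau>_def d_def)
      obtain L where L: "affine_hyperplane L"
        "\<And>(p :: int ^ 'n) q. 1 \<le> q \<Longrightarrow> real q \<le> 2 ^ Suc n \<Longrightarrow>
          dist z (rational_point p q) \<le> 2 * \<rho> n \<Longrightarrow> rational_point p q \<in> L"
        using rational_points_in_hyperplane[OF _ r] one_le_power[of "2::real" "Suc n"] by auto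
      have "E n \<inter> ball z (\<rho> n) \<subseteq> open_nbhd L (\<delta> n)"
      proof
        fix x assume x: "x \<in> E n \<inter> ball z (\<rho> n)"
        then obtain q and p :: "int ^ 'n" where q: "q \<in> {2^n..<2^Suc n}"
          and p: "\<And>i. \<bar>x $ i - of_int (p $ i) / of_nat q\<bar> \<le> \<psi> (of_nat q)"
          unfolding E_def approximable_with_def by blast
        have q1: "1 \<le> q" using q one_le_power[of "2::nat" n] by auto
        have q2: "real q \<le> 2 ^ Suc n"
          using q by (metis atLeastLessThan_iff less_imp_le of_nat_le_iff of_nat_numeral of_nat_power)
        have q3: "2 ^ n \<le> real q"
          using q by (metis atLeastLessThan_iff of_nat_le_iff of_nat_numeral of_nat_power)
        have "\<psi> (real q) \<le> \<psi> (2 ^ n)"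
          using monotone_onD[OF assms(9), of "2 ^ n" "real q"] q1 q3 by auto
        have "dist x (rational_point p q) \<le> (\<Sum>i\<in>UNIV. \<bar>(x - rational_point p q) $ i\<bar>)"
          unfolding dist_norm by (rule norm_le_l1_cart)
        also have "\<dots> \<le> (\<Sum>i\<in>(UNIV :: 'n set). \<psi> (2 ^ n))"
          using p \<open>\<psi> (real q) \<le> \<psi> (2 ^ n)\<close>
          by (intro sum_mono) (auto simp: rational_point_def intro: order_trans)
        also have "\<dots> = \<delta> n / 2" by (simp add: \<delta>_def d_def)
        finally have xp: "dist x (rational_point p q) \<le> \<delta> n / 2" .
        have "dist z (rational_point p q) \<le> dist z x + dist x (rational_point p q)"
          by (rule dist_triangle)
        also have "\<dots> \<le> 2 * \<rho> n" using x xp True by auto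
        finally have "rational_point p q \<in> L" using L(2) q1 q2 by blast
        moreover have "x \<in> ball (rational_point p q) (\<delta> n)"
          using xp \<delta>[of n] by (simp add: dist_commute)
        ultimately show "x \<in> open_nbhd L (\<delta> n)" by (auto simp: open_nbhd_def)
      qed
      with L(1) show "\<exists>L. affine_hyperplane L \<and> E n \<inter> ball z (\<rho> n) \<subseteq> open_nbhd L (\<delta> n)" by blast
    qed (use assms(1-3) D C \<rho> \<delta> small doubling decaying E_sets in \<open>auto simp: E_def\<close>)
    also have "\<dots> \<le> (1 + C * D\<^sup>2) * S * (\<delta> n / \<rho> n) powr \<alpha>"
      using S by (simp add: S_def algebra_simps)
    finally show ?thesis .
  next
    case False
    have "1 \<le> (\<delta> n / \<rho> n) powr \<alpha>"
      using False \<rho>[of n] assms(6) by (intro ge_one_powr_ge_zero) (auto simp: field_simps)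
    moreover have "measure \<mu> (E n) \<le> S" by (simp add: S_def bounded_measure)
    moreover have "1 \<le> 1 + C * D\<^sup>2" using C by simp
    ultimately have "measure \<mu> (E n) \<le> (1 + C * D\<^sup>2) * S"
      using S by (smt (verit) mult_le_cancel_right1)
    also have "\<dots> \<le> (1 + C * D\<^sup>2) * S * (\<delta> n / \<rho> n) powr \<alpha>"
      using \<open>1 \<le> (\<delta> n / \<rho> n) powr \<alpha>\<close> S C
      by (intro mult_left_mono[of 1 _ "(1 + C * D\<^sup>2) * S", unfolded mult_1_right]) auto
    finally show ?thesis .
  qed
  \<comment> \<open>\<open>B\<close> collects \<open>2 * d\<close> from \<open>\<delta>\<close>,
    \<open>16 * d\<close> from \<open>\<rho>\<close>, and \<open>2 powr \<tau>\<close> from the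
    shift from \<open>2 ^ n\<close> to \<open>2 ^ Suc n\<close>.\<close>
  define B where "B = 32 * d\<^sup>2 * 2 powr \<tau>"
  have ratio: "(\<delta> n / \<rho> n) powr \<alpha> = B powr \<alpha> * ((2 ^ n) powr (\<alpha> * \<tau>) * \<psi> (2 ^ n) powr \<alpha>)" for n
  proof -
    have "\<delta> n / \<rho> n = B * ((2 ^ n) powr \<tau> * \<psi> (2 ^ n))"
      by (simp add: \<delta>_def \<rho>_def B_def powr_mult power2_eq_square)
    moreover have "B > 0" "\<psi> (2 ^ n) > 0" using d assms(8) by (auto simp: B_def)
    ultimately show ?thesis by (simp add: powr_mult powr_powr mult.commute)
  qed
  have "summable (\<lambda>n. (2 ^ n) powr (\<alpha> * \<tau>) * \<psi> (2 ^ n) powr \<alpha>)"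
    using assms(6,8,9,10) unfolding \<tau> by (rule summable_dyadic)
  then have summ: "summable (\<lambda>n. (1 + C * D\<^sup>2) * S * (\<delta> n / \<rho> n) powr \<alpha>)"
    unfolding ratio by (intro summable_mult)
  \<comment> \<open>Doubling and decay hold only below \<open>r1\<close> and \<open>r2\<close>, so
    the bound on \<open>E n\<close> is available once \<open>\<rho> n\<close> has become
    small.\<close>
  have "\<rho> n \<le> (1 / 2) ^ n" for n
  proof -
    have "(2::real) ^ n \<le> 2 ^ Suc n" by simp
    also have "\<dots> = (2 ^ Suc n) powr 1" by simp
    also have "\<dots> \<le> (2 ^ Suc n) powr \<tau>"
      using \<tau>1 one_le_power[of "2::real" "Suc n"] by (intro powr_mono) auto
    also have "\<dots> \<le> 16 * d * (2 ^ Suc n) powr \<tau>"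
      using d by (simp add: mult_le_cancel_right1)
    finally show ?thesis unfolding \<rho>_def power_one_over by (intro divide_left_mono) (use d in auto)
  qed
  then have "\<rho> \<longlonglongrightarrow> 0"
    using \<rho> by (intro tendsto_sandwich[OF _ _ tendsto_const LIMSEQ_power_zero[of "1/2 :: real"]])
      (auto intro!: always_eventually less_imp_le)
  then have "eventually (\<lambda>n. \<rho> n < min r1 r2) sequentially"
    using D C by (intro order_tendstoD(2)) auto
  then obtain N where N: "\<And>n. n \<ge> N \<Longrightarrow> \<rho> n < min r1 r2" by (auto simp: eventually_sequentially)
  have "summable (\<lambda>n. measure \<mu> (E n))"
    using E_le N by (intro summable_comparison_test'[OF summ, of N]) auto
  then have null: "limsup E \<in> null_sets \<mu>"
    by (intro borel_cantelli_limsup1 E_sets) (auto simp: emeasure_eq_measure)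
  have "K \<inter> well_approximable \<psi> \<subseteq> limsup E"
  proof
    fix x assume x: "x \<in> K \<inter> well_approximable \<psi>"
    have "\<exists>n\<ge>m. x \<in> E n" for m
    proof -
      \<comment> \<open>A denominator of size at least \<open>2 ^ m\<close> falls in a block whose
        index is at least \<open>m\<close>.\<close>
      obtain q where q: "q \<ge> 2 ^ m" "q \<ge> 1" "x \<in> approximable_with \<psi> q"
        using x well_approximable_iff[of x \<psi>] by blast
      obtain n where n: "2 ^ n \<le> q" "q < 2 ^ Suc n"
        using ex_power_ivl1[of 2 q] q(2) by auto
      have "(2::nat) ^ m < 2 ^ Suc n" using q n by linarith
      then have "m \<le> n" by (simp del: power_Suc)
      moreover have "x \<in> E n" using n q x by (auto simp: E_def)
      ultimately show ?thesis by blast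
    qed
    then show "x \<in> limsup E" by (auto simp: limsup_INF_SUP)
  qed
  \<comment> \<open>The measure need not be complete, so inclusion in a null set does not by itself
    give measurability.\<close>
  moreover have "K \<inter> well_approximable \<psi> \<in> sets \<mu>"
  proof -
    have W: "well_approximable \<psi> = (\<Inter>N. \<Union>q\<in>{q. N \<le> q \<and> 1 \<le> q}. approximable_with \<psi> q :: (real ^ 'n) set)"
      by (auto simp: well_approximable_iff)
    have "well_approximable \<psi> \<in> sets (borel :: (real ^ 'n) measure)"
      unfolding W using approximable_with_borel
      by (intro sets.countable_INT' sets.countable_UN') auto
    then show ?thesis
      unfolding assms(2) using compact_imp_closed[OF assms(1)] by (intro sets.Int) auto
  qed
  ultimately show ?thesis using null by (auto intro: null_sets_subset)
qed

end
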